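(* In the quantum number-in-hand network model, there is a quantum protocol with communication cost $O(k\log^2 k)$ which, with probability at least $2/3$, outputs the neighborhood diversity of the input $k$-node graph.
   Context: Quantum number-in-hand (NIH) network model: the input is an undirected graph $G=(V,E)$ without self-loops on $V=[k]$; player $v\in[k]$ receives only $\nu_v\in\{0,1\}^k$, the characteristic vector of its neighborhood $N(v)$; each player sends one quantum message depending only on its own input (no shared randomness or entanglement) to a referee, who outputs the answer; cost is the total number of qubits sent. Nodes $u\ne v$ are false twins if non-adjacent with $N(u)=N(v)$, true twins if adjacent with $N(u)\cup\{u\}=N(v)\cup\{v\}$, and twins if either. The neighborhood diversity of $G$ is the minimum $d$ such that $V$ can be partitioned into $d$ sets in each of which every two distinct nodes are twins. *)

theory Defs
  imports "Jordan_Normal_Form.Matrix" "HOL-Library.Disjoint_Sets" Complex_Main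
begin

definition is_graph :: "nat \<Rightarrow> (nat \<Rightarrow> nat \<Rightarrow> bool) \<Rightarrow> bool" where
  "is_graph k E \<longleftrightarrow> (\<forall>u v. E u v \<longrightarrow> u < k \<and> v < k) \<and> (\<forall>u v. E u v \<longrightarrow> E v u) \<and> (\<forall>u. \<not> E u u)"

definition nbhd :: "nat \<Rightarrow> (nat \<Rightarrow> nat \<Rightarrow> bool) \<Rightarrow> nat \<Rightarrow> nat set" where
  "nbhd k E v = {u. u < k \<and> E v u}"

definition false_twins :: "nat \<Rightarrow> (nat \<Rightarrow> nat \<Rightarrow> bool) \<Rightarrow> nat \<Rightarrow> nat \<Rightarrow> bool" where
  "false_twins k E u v \<longleftrightarrow> u \<noteq> v \<and> \<not> E u v \<and> nbhd k E u = nbhd k E v"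

definition true_twins :: "nat \<Rightarrow> (nat \<Rightarrow> nat \<Rightarrow> bool) \<Rightarrow> nat \<Rightarrow> nat \<Rightarrow> bool" where
  "true_twins k E u v \<longleftrightarrow> u \<noteq> v \<and> E u v \<and> insert u (nbhd k E u) = insert v (nbhd k E v)"

definition twins :: "nat \<Rightarrow> (nat \<Rightarrow> nat \<Rightarrow> bool) \<Rightarrow> nat \<Rightarrow> nat \<Rightarrow> bool" where
  "twins k E u v \<longleftrightarrow> false_twins k E u v \<or> true_twins k E u v"

definition neighborhood_diversity :: "nat \<Rightarrow> (nat \<Rightarrow> nat \<Rightarrow> bool) \<Rightarrow> nat" where
  "neighborhood_diversity k E = (LEAST d. \<exists>P. partition_on {..<k} P \<and> card P = d \<and>
      (\<forall>S\<in>P. \<forall>u\<in>S. \<forall>v\<in>S. u \<noteq> v \<longrightarrow> twins k E u v))"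

definition mtrace :: "complex mat \<Rightarrow> complex" where
  "mtrace A = (\<Sum>i<dim_row A. A $$ (i, i))"

definition psd :: "nat \<Rightarrow> complex mat \<Rightarrow> bool" where
  "psd n A \<longleftrightarrow> A \<in> carrier_mat n n \<and>
     (\<forall>i<n. \<forall>j<n. A $$ (i, j) = cnj (A $$ (j, i))) \<and>
     (\<forall>x :: nat \<Rightarrow> complex. 0 \<le> Re (\<Sum>i<n. \<Sum>j<n. cnj (x i) * A $$ (i, j) * x j))"

definition density_op :: "nat \<Rightarrow> complex mat \<Rightarrow> bool" where
  "density_op n \<rho> \<longleftrightarrow> psd n \<rho> \<and> mtrace \<rho> = 1"

definition kron :: "complex mat \<Rightarrow> complex mat \<Rightarrow> complex mat" where
  "kron A B = mat (dim_row A * dim_row B) (dim_col A * dim_col B)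
     (\<lambda>(i, j). A $$ (i div dim_row B, j div dim_col B) * B $$ (i mod dim_row B, j mod dim_col B))"

definition kron_list :: "complex mat list \<Rightarrow> complex mat" where
  "kron_list As = foldr kron As (mat 1 1 (\<lambda>_. 1))"

definition povm :: "nat \<Rightarrow> nat \<Rightarrow> (nat \<Rightarrow> complex mat) \<Rightarrow> bool" where
  "povm D m M \<longleftrightarrow> (\<forall>r<m. psd D (M r)) \<and>
     (\<forall>a<D. \<forall>b<D. (\<Sum>r<m. M r $$ (a, b)) = (if a = b then 1 else 0))"

text \<open>Player v (v < k) sends q v qubits; on input (its neighbourhood) S it sends the
  (possibly mixed) state \<sigma> v S on 2^(q v) dimensions.  The referee performs the POVM M
  with outcomes 0..<m on the joint state of all messages and outputs the outcome.\<close>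
definition qnih_protocol ::
  "nat \<Rightarrow> (nat \<Rightarrow> nat) \<Rightarrow> (nat \<Rightarrow> nat set \<Rightarrow> complex mat) \<Rightarrow> nat \<Rightarrow> (nat \<Rightarrow> complex mat) \<Rightarrow> bool" where
  "qnih_protocol k q \<sigma> m M \<longleftrightarrow>
     (\<forall>v<k. \<forall>S. S \<subseteq> {..<k} \<longrightarrow> density_op (2 ^ q v) (\<sigma> v S)) \<and>
     povm (2 ^ (\<Sum>v<k. q v)) m M"

definition qnih_cost :: "nat \<Rightarrow> (nat \<Rightarrow> nat) \<Rightarrow> nat" where
  "qnih_cost k q = (\<Sum>v<k. q v)"

definition joint_state :: "nat \<Rightarrow> (nat \<Rightarrow> nat set \<Rightarrow> complex mat) \<Rightarrow> (nat \<Rightarrow> nat \<Rightarrow> bool) \<Rightarrow> complex mat" where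
  "joint_state k \<sigma> E = kron_list (map (\<lambda>v. \<sigma> v (nbhd k E v)) [0..<k])"

definition output_prob ::
  "nat \<Rightarrow> (nat \<Rightarrow> nat set \<Rightarrow> complex mat) \<Rightarrow> nat \<Rightarrow> (nat \<Rightarrow> complex mat) \<Rightarrow> (nat \<Rightarrow> nat \<Rightarrow> bool) \<Rightarrow> nat \<Rightarrow> real" where
  "output_prob k \<sigma> m M E d = (if d < m then Re (mtrace (M d * joint_state k \<sigma> E)) else 0)"

end

theory Submission
  imports Defs "HOL-Analysis.L2_Norm" "HOL-Combinatorics.Transposition" "HOL-Library.FuncSet"
begin

text \<open>Two vertices are twins iff their open or their closed neighbourhoods agree, so the neighborhood
  diversity is determined by equality tests. Every player sends \<open>t = O(log k)\<close> copies of a quantum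
  fingerprint of its open neighbourhood and \<open>t\<close> of its closed one; a fingerprint has \<open>O(log k)\<close> qubits,
  and distinct sets have overlap at most 1/2. For each pair of players and each kind of
  neighbourhood the referee projects onto the space fixed by swapping any of the \<open>t\<close> corresponding
  registers. The joint state is fixed if the sets agree, and otherwise its projection has squared norm
  at most \<open>(5/8)^t\<close>, which is polynomially small. Hence no test disturbs the state noticeably, and all
  \<open>2 k^2\<close> tests can be performed one after the other on the same copies.\<close>

section \<open>Sequential projective measurements\<close>

text \<open>Fingerprint amplitudes and swap tests are real, so states are real functions on a set
  \<open>X\<close> of basis labels; complex matrices enter only when the protocol is
  assembled.\<close>

definition ip :: "'x set \<Rightarrow> ('x \<Rightarrow> real) \<Rightarrow> ('x \<Rightarrow> real) \<Rightarrow> real" where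
  "ip X f g = (\<Sum>x\<in>X. f x * g x)"

definition linear_op :: "(('x \<Rightarrow> real) \<Rightarrow> 'x \<Rightarrow> real) \<Rightarrow> bool" where
  "linear_op P \<longleftrightarrow> (\<forall>c f g. P (\<lambda>x. c * f x + g x) = (\<lambda>x. c * P f x + P g x))"

text \<open>Symmetry and idempotence are demanded only as seen by \<open>ip X\<close>, so values
  outside \<open>X\<close> do not matter for them.\<close>

definition projector :: "'x set \<Rightarrow> (('x \<Rightarrow> real) \<Rightarrow> 'x \<Rightarrow> real) \<Rightarrow> bool" where
  "projector X P \<longleftrightarrow> linear_op P \<and>
     (\<forall>f g. ip X (P f) g = ip X f (P g)) \<and> (\<forall>f g. ip X (P f) (P g) = ip X f (P g))"

definition delta :: "'x \<Rightarrow> 'x \<Rightarrow> real" where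
  "delta y x = (if x = y then 1 else 0)"

lemma ip_diff:
  "ip X (\<lambda>x. f x - f' x) (\<lambda>x. g x - g' x) = ip X f g - ip X f g' - ip X f' g + ip X f' g'"
  unfolding ip_def sum_subtractf[symmetric] sum.distrib[symmetric]
  by (rule sum.cong) (auto simp: algebra_simps)

lemma ip_self_nonneg: "0 \<le> ip X f f"
  unfolding ip_def by (intro sum_nonneg) simp

lemma L2_set_ip: "L2_set f X = sqrt (ip X f f)"
  by (simp add: L2_set_def ip_def power2_eq_square)

lemma linear_opD: "linear_op P \<Longrightarrow> P (\<lambda>x. c * f x + g x) = (\<lambda>x. c * P f x + P g x)"
  by (simp add: linear_op_def)

lemma linear_op_diff:
  assumes "linear_op P"
  shows "P (\<lambda>x. f x - g x) = (\<lambda>x. P f x - P g x)"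
  using linear_opD[OF assms, of "-1" g f] by simp

lemma linear_op_sum:
  assumes "linear_op P" and "finite J"
  shows "P (\<lambda>x. \<Sum>j\<in>J. c j * g j x) = (\<lambda>x. \<Sum>j\<in>J. c j * P (g j) x)"
  using assms(2)
proof induction
  case empty
  show ?case using linear_op_diff[OF assms(1), of "\<lambda>_. 0" "\<lambda>_. 0"] by simp
next
  case (insert j J)
  then show ?case using linear_opD[OF assms(1)] by simp
qed

text \<open>\<open>seq_meas P ts A\<close> is the Kraus operator of performing the tests \<open>ts\<close> one after the
  other and accepting exactly those in \<open>A\<close>.\<close>

fun seq_meas ::
  "('t \<Rightarrow> ('x \<Rightarrow> real) \<Rightarrow> 'x \<Rightarrow> real) \<Rightarrow> 't list \<Rightarrow> 't set \<Rightarrow> ('x \<Rightarrow> real) \<Rightarrow> 'x \<Rightarrow> real" where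
  "seq_meas P [] A f = f"
| "seq_meas P (t # ts) A f = seq_meas P ts A (if t \<in> A then P t f else (\<lambda>x. f x - P t f x))"

lemma linear_op_branch:
  assumes "linear_op P"
  shows "linear_op (\<lambda>f. if b then P f else (\<lambda>x. f x - P f x))"
  using linear_opD[OF assms] by (cases b) (auto simp: linear_op_def fun_eq_iff algebra_simps)

lemma linear_op_seq_meas:
  assumes "\<And>t. t \<in> set ts \<Longrightarrow> linear_op (P t)"
  shows "linear_op (seq_meas P ts A)"
  using assms
proof (induction ts)
  case Nil
  then show ?case by (simp add: linear_op_def)
next
  case (Cons t ts)
  have "linear_op (\<lambda>f. if t \<in> A then P t f else (\<lambda>x. f x - P t f x))"
    using Cons.prems by (intro linear_op_branch) simp
  moreover have "linear_op (seq_meas P ts A)"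
    using Cons by simp
  ultimately show ?case
    unfolding linear_op_def seq_meas.simps by presburger
qed

lemma seq_meas_cong:
  "A \<inter> set ts = B \<inter> set ts \<Longrightarrow> seq_meas P ts A = seq_meas P ts B"
proof (induction ts)
  case (Cons t ts)
  have "t \<in> A \<longleftrightarrow> t \<in> B" and "A \<inter> set ts = B \<inter> set ts"
    using Cons.prems by auto
  then show ?case using Cons.IH by (auto simp: fun_eq_iff)
qed (simp add: fun_eq_iff)

text \<open>Pythagoras in bilinear form: symmetry and idempotence cancel the cross terms, so the two
  branches of one test together preserve inner products.\<close>

lemma ip_split:
  assumes "projector X P"
  shows "ip X (P f) (P g) + ip X (\<lambda>x. f x - P f x) (\<lambda>x. g x - P g x) = ip X f g"
proof -
  have "ip X (P f) g = ip X f (P g)" and "ip X (P f) (P g) = ip X f (P g)"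
    using assms unfolding projector_def by blast+
  then show ?thesis by (simp add: ip_diff)
qed

text \<open>The completeness relation of the Kraus operators, which later yields a POVM. Outcome
  records are split by whether they contain the first test, and \<open>ip_split\<close> merges the
  two halves. Since the tests are distinct, a record determines the answer at every
  position.\<close>

lemma seq_meas_complete:
  assumes "distinct ts" and "\<And>t. t \<in> set ts \<Longrightarrow> projector X (P t)"
  shows "(\<Sum>A\<in>Pow (set ts). ip X (seq_meas P ts A f) (seq_meas P ts A g)) = ip X f g"
  using assms
proof (induction ts arbitrary: f g)
  case Nil
  then show ?case by simp
next
  case (Cons t ts)
  let ?S = "\<lambda>A f. seq_meas P ts A f" and ?Q = "\<lambda>f x. f x - P t f x"
  have t: "t \<notin> set ts" using Cons.prems by simp
  have IH: "(\<Sum>A\<in>Pow (set ts). ip X (?S A f) (?S A g)) = ip X f g" for f g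
    using Cons by simp
  have eq: "?S (insert t A) = ?S A" for A
    using t by (intro seq_meas_cong) auto
  have inj: "inj_on (insert t) (Pow (set ts))"
    using t by (intro inj_onI) (metis PowD insert_ident subsetD)
  have disj: "Pow (set ts) \<inter> insert t ` Pow (set ts) = {}"
    using t by auto
  have A: "(\<Sum>A\<in>Pow (set ts). ip X (seq_meas P (t # ts) A f) (seq_meas P (t # ts) A g)) =
      ip X (?Q f) (?Q g)"
    using t by (subst IH[of "?Q f" "?Q g", symmetric]) (auto intro!: sum.cong)
  have B: "(\<Sum>A\<in>insert t ` Pow (set ts). ip X (seq_meas P (t # ts) A f) (seq_meas P (t # ts) A g)) =
      ip X (P t f) (P t g)"
    unfolding sum.reindex[OF inj] by (simp add: eq IH)
  have "projector X (P t)" using Cons.prems by simp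
  from ip_split[OF this, of f g] show ?case
    unfolding list.set Pow_insert sum.union_disjoint[OF finite_Pow_iff[THEN iffD2, OF finite_set]
      finite_imageI[OF finite_Pow_iff[THEN iffD2, OF finite_set]] disj] A B
    by (simp only: add.commute)
qed

lemma L2_branch_le:
  assumes "projector X P"
  shows "L2_set (if b then P f else (\<lambda>x. f x - P f x)) X \<le> L2_set f X"
proof -
  have "ip X (P f) (P f) \<le> ip X f f" and
    "ip X (\<lambda>x. f x - P f x) (\<lambda>x. f x - P f x) \<le> ip X f f"
    using ip_split[OF assms, of f f] ip_self_nonneg[of X "P f"]
      ip_self_nonneg[of X "\<lambda>x. f x - P f x"] by linarith+
  then show ?thesis by (simp add: L2_set_ip)
qed

lemma L2_seq_meas_le:
  assumes "\<And>t. t \<in> set ts \<Longrightarrow> projector X (P t)"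
  shows "L2_set (seq_meas P ts A f) X \<le> L2_set f X"
  using assms
proof (induction ts arbitrary: f)
  case (Cons t ts)
  have "projector X (P t)" using Cons.prems by simp
  from L2_branch_le[OF this, of "t \<in> A" f] Cons.IH Cons.prems show ?case
    unfolding seq_meas.simps by (meson list.set_intros order_trans)
qed simp

text \<open>When every test is almost certain to answer as prescribed by \<open>A\<close>, errors only add up, since
  later steps are contractions.\<close>

lemma seq_meas_gentle:
  assumes "\<And>t. t \<in> set ts \<Longrightarrow> projector X (P t)"
    and "\<And>t. t \<in> set ts \<Longrightarrow> t \<in> A \<Longrightarrow> L2_set (\<lambda>x. f x - P t f x) X \<le> e"
    and "\<And>t. t \<in> set ts \<Longrightarrow> t \<notin> A \<Longrightarrow> L2_set (P t f) X \<le> e"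
  shows "L2_set (\<lambda>x. f x - seq_meas P ts A f x) X \<le> real (length ts) * e"
  using assms
proof (induction ts)
  case Nil
  then show ?case by (simp add: L2_set_def)
next
  case (Cons t ts)
  let ?g = "if t \<in> A then P t f else (\<lambda>x. f x - P t f x)"
  let ?K = "seq_meas P ts A"
  have pr: "\<And>t. t \<in> set ts \<Longrightarrow> projector X (P t)" using Cons.prems by simp
  have lin: "linear_op ?K"
    using pr by (intro linear_op_seq_meas) (auto simp: projector_def)
  have K: "L2_set (?K h) X \<le> L2_set h X" for h
    by (rule L2_seq_meas_le) (rule pr)
  have "L2_set (\<lambda>x. f x - ?g x) X \<le> e"
    using Cons.prems(2,3)[of t] by auto
  then have 1: "L2_set (?K (\<lambda>x. f x - ?g x)) X \<le> e"
    using K[of "\<lambda>x. f x - ?g x"] by linarith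
  have 2: "L2_set (\<lambda>x. f x - ?K f x) X \<le> real (length ts) * e"
    using Cons by simp
  \<comment> \<open>Telescoping: the first summand is the error of the remaining tests started on
    the undisturbed \<open>f\<close>, the second is the error of test \<open>t\<close> carried
    through the contraction \<open>?K\<close>.\<close>
  have "(\<lambda>x. f x - ?K ?g x) = (\<lambda>x. (f x - ?K f x) + ?K (\<lambda>x. f x - ?g x) x)"
    unfolding linear_op_diff[OF lin] by (simp add: fun_eq_iff)
  then have "L2_set (\<lambda>x. f x - ?K ?g x) X \<le> L2_set (\<lambda>x. f x - ?K f x) X + L2_set (?K (\<lambda>x. f x - ?g x)) X"
    by (simp only: L2_set_triangle_ineq)
  with 1 2 have "L2_set (\<lambda>x. f x - ?K ?g x) X \<le> real (length ts) * e + e"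
    by linarith
  then show ?case by (simp add: distrib_right add.commute)
qed

text \<open>Turns closeness in norm into a probability: a branch within \<open>length ts * e\<close>
  of a unit vector has norm at least \<open>1 - length ts * e\<close> by the triangle inequality.
  The last hypothesis keeps this bound nonnegative, so it may be squared.\<close>

lemma seq_meas_prob:
  assumes "\<And>t. t \<in> set ts \<Longrightarrow> projector X (P t)"
    and "\<And>t. t \<in> set ts \<Longrightarrow> t \<in> A \<Longrightarrow> L2_set (\<lambda>x. f x - P t f x) X \<le> e"
    and "\<And>t. t \<in> set ts \<Longrightarrow> t \<notin> A \<Longrightarrow> L2_set (P t f) X \<le> e"
    and "ip X f f = 1" and "real (length ts) * e \<le> 1"
  shows "(1 - real (length ts) * e)\<^sup>2 \<le> ip X (seq_meas P ts A f) (seq_meas P ts A f)"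
proof -
  let ?K = "seq_meas P ts A f"
  have "1 = L2_set (\<lambda>x. (f x - ?K x) + ?K x) X"
    using assms(4) by (simp add: L2_set_ip)
  also have "\<dots> \<le> L2_set (\<lambda>x. f x - ?K x) X + L2_set ?K X"
    by (rule L2_set_triangle_ineq)
  finally have "1 - real (length ts) * e \<le> L2_set ?K X"
    using seq_meas_gentle[of ts X P A f e] assms(1-3) by force
  then have "(1 - real (length ts) * e)\<^sup>2 \<le> (L2_set ?K X)\<^sup>2"
    using assms(5) by (intro power_mono) auto
  then show ?thesis by (simp add: L2_set_ip ip_self_nonneg)
qed

section \<open>States and effects as matrices\<close>

text \<open>The sum of (adjoint of \<open>K A\<close>) times \<open>K A\<close> in the basis
  enumerated by \<open>co\<close>: the POVM element for the event that the outcome record lies in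
  the given family.\<close>

definition effect ::
  "nat \<Rightarrow> (nat \<Rightarrow> 'x) \<Rightarrow> 'x set \<Rightarrow> 'o set \<Rightarrow> ('o \<Rightarrow> ('x \<Rightarrow> real) \<Rightarrow> 'x \<Rightarrow> real) \<Rightarrow> complex mat" where
  "effect D co X \<A> K = mat D D (\<lambda>(i, j).
     of_real (\<Sum>A\<in>\<A>. ip X (K A (delta (co i))) (K A (delta (co j)))))"

definition pure_state :: "nat \<Rightarrow> (nat \<Rightarrow> real) \<Rightarrow> complex mat" where
  "pure_state D \<phi> = mat D D (\<lambda>(i, j). of_real (\<phi> i * \<phi> j))"

text \<open>The quadratic form is a sum of squared moduli \<open>cmod (s y)\<close>. One vector
  gives pure states, a family of vectors gives effects.\<close>

lemma psd_gram:
  assumes "finite Y"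
  shows "psd D (mat D D (\<lambda>(i, j). of_real (\<Sum>y\<in>Y. w y i * w y j)))"
  unfolding psd_def
proof (intro conjI allI impI)
  fix z :: "nat \<Rightarrow> complex"
  define s where "s y = (\<Sum>j<D. of_real (w y j) * z j)" for y
  have "(\<Sum>i<D. \<Sum>j<D. cnj (z i) * mat D D (\<lambda>(i, j). of_real (\<Sum>y\<in>Y. w y i * w y j)) $$ (i, j) * z j)
      = (\<Sum>i<D. \<Sum>j<D. \<Sum>y\<in>Y. cnj (of_real (w y i) * z i) * (of_real (w y j) * z j))"
    by (intro sum.cong refl) (simp add: sum_distrib_left sum_distrib_right mult_ac)
  also have "\<dots> = (\<Sum>y\<in>Y. \<Sum>i<D. \<Sum>j<D. cnj (of_real (w y i) * z i) * (of_real (w y j) * z j))"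
    by (subst (2) sum.swap) (subst sum.swap, rule refl)
  also have "\<dots> = (\<Sum>y\<in>Y. cnj (s y) * s y)"
    unfolding s_def cnj_sum sum_product by simp
  also have "\<dots> = of_real (\<Sum>y\<in>Y. (cmod (s y))\<^sup>2)"
    by (simp add: complex_norm_square mult.commute del: of_real_power)
  finally show "0 \<le> Re (\<Sum>i<D. \<Sum>j<D. cnj (z i) *
      mat D D (\<lambda>(i, j). of_real (\<Sum>y\<in>Y. w y i * w y j)) $$ (i, j) * z j)"
    by (simp add: sum_nonneg)
qed (auto simp: mult_ac)

lemma density_op_pure_state:
  assumes "(\<Sum>i<D. (\<phi> i)\<^sup>2) = 1"
  shows "density_op D (pure_state D \<phi>)"
proof -
  have "psd D (pure_state D \<phi>)"
    using psd_gram[of "{()}" D "\<lambda>_. \<phi>"] by (simp add: pure_state_def)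
  moreover have "mtrace (pure_state D \<phi>) = of_real (\<Sum>i<D. (\<phi> i)\<^sup>2)"
    by (simp add: mtrace_def pure_state_def power2_eq_square)
  ultimately show ?thesis using assms by (simp add: density_op_def)
qed

lemma psd_effect:
  assumes "finite X" and "finite \<A>"
  shows "psd D (effect D co X \<A> K)"
  using psd_gram[of "\<A> \<times> X" D "\<lambda>(A, x) i. K A (delta (co i)) x"] assms
  by (simp add: effect_def ip_def sum.cartesian_product case_prod_unfold)

text \<open>The Born rule: it links the trace in the protocol model to squared norms of branches.
  Expanding \<open>f\<close> in basis vectors makes both sides the same double sum.\<close>

lemma mtrace_effect:
  assumes "finite X" and "finite \<A>" and "\<And>A. A \<in> \<A> \<Longrightarrow> linear_op (K A)"
    and "\<And>x. f x = (\<Sum>i<D. \<phi> i * delta (co i) x)"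
  shows "mtrace (effect D co X \<A> K * pure_state D \<phi>) = of_real (\<Sum>A\<in>\<A>. ip X (K A f) (K A f))"
proof -
  have f: "f = (\<lambda>x. \<Sum>i<D. \<phi> i * delta (co i) x)" using assms(4) by auto
  have K: "K A f = (\<lambda>x. \<Sum>i<D. \<phi> i * K A (delta (co i)) x)" if "A \<in> \<A>" for A
    unfolding f using assms(3)[OF that] by (intro linear_op_sum) auto
  have ipK: "ip X (K A f) (K A f) =
      (\<Sum>i<D. \<Sum>j<D. \<phi> i * \<phi> j * ip X (K A (delta (co i))) (K A (delta (co j))))" if "A \<in> \<A>" for A
  proof -
    let ?k = "\<lambda>i x. K A (delta (co i)) x"
    have "ip X (K A f) (K A f) = (\<Sum>x\<in>X. \<Sum>i<D. \<Sum>j<D. \<phi> i * \<phi> j * (?k i x * ?k j x))"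
      unfolding ip_def K[OF that] sum_product by (simp add: mult_ac)
    also have "\<dots> = (\<Sum>i<D. \<Sum>j<D. \<Sum>x\<in>X. \<phi> i * \<phi> j * (?k i x * ?k j x))"
      by (subst sum.swap) (subst sum.swap, rule refl)
    finally show ?thesis by (simp add: ip_def sum_distrib_left)
  qed
  have "mtrace (effect D co X \<A> K * pure_state D \<phi>) =
      (\<Sum>i<D. \<Sum>j<D. effect D co X \<A> K $$ (i, j) * pure_state D \<phi> $$ (j, i))"
    by (simp add: mtrace_def effect_def pure_state_def scalar_prod_def atLeast0LessThan)
  also have "\<dots> = (\<Sum>i<D. \<Sum>j<D. of_real (\<Sum>A\<in>\<A>. \<phi> i * \<phi> j * ip X (K A (delta (co i))) (K A (delta (co j)))))"
    by (intro sum.cong refl)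
      (simp add: effect_def pure_state_def sum_distrib_left[symmetric] mult_ac)
  also have "\<dots> =
      of_real (\<Sum>i<D. \<Sum>j<D. \<Sum>A\<in>\<A>. \<phi> i * \<phi> j * ip X (K A (delta (co i))) (K A (delta (co j))))"
    by simp
  also have "(\<Sum>i<D. \<Sum>j<D. \<Sum>A\<in>\<A>. \<phi> i * \<phi> j * ip X (K A (delta (co i))) (K A (delta (co j)))) =
     (\<Sum>A\<in>\<A>. \<Sum>i<D. \<Sum>j<D. \<phi> i * \<phi> j * ip X (K A (delta (co i))) (K A (delta (co j))))"
    by (subst (2) sum.swap) (subst sum.swap, rule refl)
  also have "\<dots> = (\<Sum>A\<in>\<A>. ip X (K A f) (K A f))"
    by (simp add: ipK)
  finally show ?thesis .
qed

text \<open>Classical post-processing: merging outcome records with equal output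
  \<open>out A\<close> only regroups the completeness relation. The bound on \<open>out\<close>
  ensures that no record is lost in the regrouping.\<close>

lemma povm_effect:
  assumes "bij_betw co {..<D} X" and "finite \<A>" and "\<And>A. A \<in> \<A> \<Longrightarrow> out A < m"
    and "\<And>f g. (\<Sum>A\<in>\<A>. ip X (K A f) (K A g)) = ip X f g"
  shows "povm D m (\<lambda>r. effect D co X {A \<in> \<A>. out A = r} K)"
  unfolding povm_def
proof (intro conjI allI impI)
  have X: "finite X" using bij_betw_finite[OF assms(1)] by simp
  show "psd D (effect D co X {A \<in> \<A>. out A = r} K)" for r
    using X assms(2) by (intro psd_effect) auto
  fix a b assume ab: "a < D" "b < D"
  have "(\<Sum>r<m. effect D co X {A \<in> \<A>. out A = r} K $$ (a, b)) =
      of_real (\<Sum>r<m. \<Sum>A\<in>{A \<in> \<A>. out A = r}. ip X (K A (delta (co a))) (K A (delta (co b))))"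
    using ab by (simp add: effect_def)
  also have "\<dots> = of_real (ip X (delta (co a)) (delta (co b)))"
    using assms(2,3) by (subst sum.group) (auto simp: assms(4))
  also have "ip X (delta (co a)) (delta (co b)) = (if co a = co b then 1 else 0)"
  proof -
    have "ip X (delta (co a)) (delta (co b)) = (\<Sum>x\<in>X. if x = co b then delta (co a) x else 0)"
      unfolding ip_def by (intro sum.cong) (auto simp: delta_def)
    also have "\<dots> = delta (co a) (co b)"
      using X ab bij_betwE[OF assms(1)] by simp
    finally show ?thesis by (auto simp: delta_def)
  qed
  also have "\<dots> = (if a = b then 1 else 0)"
    using ab bij_betw_imp_inj_on[OF assms(1)] by (auto dest: inj_onD)
  finally show "(\<Sum>r<m. effect D co X {A \<in> \<A>. out A = r} K $$ (a, b)) = (if a = b then 1 else 0)"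
    by simp
qed

section \<open>Digit expansions as coordinates of tensor products\<close>

text \<open>An index is read as \<open>k\<close> digits in base \<open>B\<close>, most significant
  first, matching the \<open>div\<close> and \<open>mod\<close> in \<open>kron\<close>. The same
  \<open>dec\<close> serves all matrix families, so it can be fixed before the input graph.\<close>

lemma kron_index_bij:
  assumes "0 < B"
  obtains dec :: "nat \<Rightarrow> nat \<Rightarrow> nat" where
    "bij_betw dec {..<B ^ k} (PiE {..<k} (\<lambda>_. {..<B}))"
    "\<And>A. (\<And>v. v < k \<Longrightarrow> A v \<in> carrier_mat B B) \<Longrightarrow>
      kron_list (map A [0..<k]) = mat (B ^ k) (B ^ k) (\<lambda>(i, j). \<Prod>v<k. A v $$ (dec i v, dec j v))"
proof -
  have "\<exists>dec :: nat \<Rightarrow> nat \<Rightarrow> nat. bij_betw dec {..<B ^ k} (PiE {..<k} (\<lambda>_. {..<B})) \<and>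
    (\<forall>A. (\<forall>v<k. A v \<in> carrier_mat B B) \<longrightarrow>
      kron_list (map A [0..<k]) = mat (B ^ k) (B ^ k) (\<lambda>(i, j). \<Prod>v<k. A v $$ (dec i v, dec j v)))"
  proof (induction k)
    case 0
    show ?case
      by (rule exI[of _ "\<lambda>_ _. undefined"])
        (auto simp: kron_list_def bij_betw_def inj_on_def intro!: eq_matI)
  next
    case (Suc k)
    then obtain dec :: "nat \<Rightarrow> nat \<Rightarrow> nat" where
      bij: "bij_betw dec {..<B ^ k} (PiE {..<k} (\<lambda>_. {..<B}))" and
      kron: "\<And>A. (\<forall>v<k. A v \<in> carrier_mat B B) \<Longrightarrow>
        kron_list (map A [0..<k]) = mat (B ^ k) (B ^ k) (\<lambda>(i, j). \<Prod>v<k. A v $$ (dec i v, dec j v))"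
      by blast
    \<comment> \<open>The leading digit belongs to the outermost Kronecker factor; the remaining
      digits come from the induction hypothesis.\<close>
    define dec' where "dec' i v = (case v of 0 \<Rightarrow> i div B ^ k | Suc w \<Rightarrow> dec (i mod B ^ k) w)" for i v
    have dec': "dec' i 0 = i div B ^ k" "dec' i (Suc w) = dec (i mod B ^ k) w" for i w
      by (simp_all add: dec'_def)
    have divlt: "i div B ^ k < B" if "i < B ^ Suc k" for i
      using that assms by (simp add: less_mult_imp_div_less)
    have modlt: "i mod B ^ k < B ^ k" for i
      using assms by simp
    have inj: "inj_on dec' {..<B ^ Suc k}"
    proof (rule inj_onI)
      fix i j assume eq: "dec' i = dec' j"
      have "i div B ^ k = j div B ^ k" using fun_cong[OF eq, of 0] by (simp add: dec')
      moreover have "dec (i mod B ^ k) = dec (j mod B ^ k)"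
      proof
        fix w show "dec (i mod B ^ k) w = dec (j mod B ^ k) w"
          using fun_cong[OF eq, of "Suc w"] by (simp add: dec')
      qed
      then have "i mod B ^ k = j mod B ^ k"
        using bij_betw_imp_inj_on[OF bij] modlt by (auto dest: inj_onD)
      ultimately show "i = j" by (metis div_mult_mod_eq)
    qed
    have sub: "dec' ` {..<B ^ Suc k} \<subseteq> PiE {..<Suc k} (\<lambda>_. {..<B})"
    proof
      fix x assume "x \<in> dec' ` {..<B ^ Suc k}"
      then obtain i where i: "i < B ^ Suc k" "x = dec' i" by auto
      have mem: "dec (i mod B ^ k) \<in> PiE {..<k} (\<lambda>_. {..<B})"
        using bij_betwE[OF bij] modlt by simp
      show "x \<in> PiE {..<Suc k} (\<lambda>_. {..<B})"
      proof (rule PiE_I)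
        show "x v \<in> {..<B}" if "v \<in> {..<Suc k}" for v
          using that i divlt PiE_mem[OF mem] by (cases v) (auto simp: dec')
        show "x v = undefined" if "v \<notin> {..<Suc k}" for v
          using that i PiE_arb[OF mem] by (cases v) (auto simp: dec')
      qed
    qed
    \<comment> \<open>Surjectivity by counting: the injective image has as many elements as the
      finite set containing it.\<close>
    have "card (dec' ` {..<B ^ Suc k}) = card (PiE {..<Suc k} (\<lambda>_. {..<B}))"
      unfolding card_image[OF inj] by (simp add: card_PiE)
    then have "dec' ` {..<B ^ Suc k} = PiE {..<Suc k} (\<lambda>_. {..<B})"
      by (intro card_subset_eq[OF _ sub] finite_PiE) auto
    then have bij': "bij_betw dec' {..<B ^ Suc k} (PiE {..<Suc k} (\<lambda>_. {..<B}))"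
      using inj by (simp add: bij_betw_def)
    have "kron_list (map A [0..<Suc k]) =
        mat (B ^ Suc k) (B ^ Suc k) (\<lambda>(i, j). \<Prod>v<Suc k. A v $$ (dec' i v, dec' j v))"
      if A: "\<forall>v<Suc k. A v \<in> carrier_mat B B" for A
    proof -
      have map: "map A [0..<Suc k] = A 0 # map (\<lambda>v. A (Suc v)) [0..<k]"
        by (simp only: upt_conv_Cons[of 0 "Suc k"] map_Suc_upt[symmetric] zero_less_Suc list.map map_map comp_def One_nat_def)
      have "kron_list (map (\<lambda>v. A (Suc v)) [0..<k]) =
          mat (B ^ k) (B ^ k) (\<lambda>(i, j). \<Prod>v<k. A (Suc v) $$ (dec i v, dec j v))"
        using A by (intro kron) auto
      then have "kron_list (map A [0..<Suc k]) =
          kron (A 0) (mat (B ^ k) (B ^ k) (\<lambda>(i, j). \<Prod>v<k. A (Suc v) $$ (dec i v, dec j v)))"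
        unfolding map by (simp add: kron_list_def)
      also have "\<dots> = mat (B ^ Suc k) (B ^ Suc k) (\<lambda>(i, j). \<Prod>v<Suc k. A v $$ (dec' i v, dec' j v))"
        using A assms unfolding prod.lessThan_Suc_shift
        by (intro eq_matI) (auto simp: kron_def dec')
      finally show ?thesis .
    qed
    with bij' show ?case by blast
  qed
  then show thesis using that by blast
qed

text \<open>Expands each player's digit in base \<open>B ^ L\<close> once more, into the
  \<open>L\<close> registers of that player, so that basis labels become functions on pairs (player,
  register).\<close>

lemma nested_index_bij:
  fixes dec dl :: "nat \<Rightarrow> nat \<Rightarrow> nat"
  assumes dec: "bij_betw dec {..<(B ^ L) ^ k} (PiE {..<k} (\<lambda>_. {..<B ^ L}))"
    and dl: "bij_betw dl {..<B ^ L} (PiE {..<L} (\<lambda>_. {..<B}))"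
  shows "bij_betw (\<lambda>i. restrict (\<lambda>(v, l). dl (dec i v) l) ({..<k} \<times> {..<L}))
    {..<(B ^ L) ^ k} (PiE ({..<k} \<times> {..<L}) (\<lambda>_. {..<B}))" (is "bij_betw ?co ?D ?X")
proof -
  have lt: "dec i v < B ^ L" if "i \<in> ?D" "v < k" for i v
    using bij_betwE[OF dec] that by (auto dest: PiE_mem)
  have inj: "inj_on ?co ?D"
  proof (rule inj_onI)
    fix i j assume ij: "i \<in> ?D" "j \<in> ?D" and eq: "?co i = ?co j"
    have "dec i v = dec j v" if v: "v \<in> {..<k}" for v
    proof -
      have "dl (dec i v) l = dl (dec j v) l" if "l \<in> {..<L}" for l
        using fun_cong[OF eq, of "(v, l)"] v that by simp
      then have "dl (dec i v) = dl (dec j v)"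
        using bij_betwE[OF dl] lt ij v by (intro PiE_ext[of _ "{..<L}" "\<lambda>_. {..<B}"]) auto
      then show ?thesis
        using bij_betw_imp_inj_on[OF dl] lt ij v by (auto dest: inj_onD)
    qed
    then have "dec i = dec j"
      using bij_betwE[OF dec] ij by (intro PiE_ext[of _ "{..<k}" "\<lambda>_. {..<B ^ L}"]) auto
    then show "i = j"
      using bij_betw_imp_inj_on[OF dec] ij by (auto dest: inj_onD)
  qed
  have sub: "?co ` ?D \<subseteq> ?X"
  proof (rule image_subsetI, rule PiE_I)
    fix i p assume i: "i \<in> ?D" and p: "p \<in> {..<k} \<times> {..<L}"
    obtain v l where vl: "p = (v, l)" "v < k" "l < L" using p by (cases p) auto
    have "dl (dec i v) \<in> PiE {..<L} (\<lambda>_. {..<B})"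
      using bij_betwE[OF dl] lt[OF i vl(2)] by simp
    then show "?co i p \<in> {..<B}"
      using vl by (auto dest: PiE_mem)
  qed simp
  have "card (?co ` ?D) = card ?X"
    unfolding card_image[OF inj]
    by (simp add: card_PiE card_cartesian_product power_mult[symmetric] mult.commute)
  then have "?co ` ?D = ?X"
    by (intro card_subset_eq[OF _ sub] finite_PiE) auto
  with inj show ?thesis by (simp add: bij_betw_def)
qed

section \<open>The swap test\<close>

definition swap_regs :: "'v \<Rightarrow> 'v \<Rightarrow> 'l set \<Rightarrow> 'v \<times> 'l \<Rightarrow> 'v \<times> 'l" where
  "swap_regs u v T = (\<lambda>(w, l). (if l \<in> T then Transposition.transpose u v w else w, l))"

text \<open>Averaging over the subsets of \<open>J\<close> expands the product over \<open>l \<in> J\<close> of the commuting projectors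
  \<open>(1 + swap of register l)/2\<close>.\<close>

definition swap_test ::
  "'v \<Rightarrow> 'v \<Rightarrow> 'l set \<Rightarrow> (('v \<times> 'l \<Rightarrow> 'd) \<Rightarrow> real) \<Rightarrow> ('v \<times> 'l \<Rightarrow> 'd) \<Rightarrow> real" where
  "swap_test u v J f = (\<lambda>x. (\<Sum>T\<in>Pow J. f (x \<circ> swap_regs u v T)) / 2 ^ card J)"

text \<open>The value 0 outside the basis labels makes the state equal everywhere to its expansion
  in vectors \<open>delta\<close>, as \<open>mtrace_effect\<close> requires.\<close>

definition product_state :: "'r set \<Rightarrow> 'd set \<Rightarrow> ('r \<Rightarrow> 'd \<Rightarrow> real) \<Rightarrow> ('r \<Rightarrow> 'd) \<Rightarrow> real" where
  "product_state R B h x = (if x \<in> PiE R (\<lambda>_. B) then \<Prod>r\<in>R. h r (x r) else 0)"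

text \<open>For fixed \<open>u\<close> and \<open>v\<close> the swaps form a group under symmetric
  difference of slot sets; averaging over a subgroup is a projection.\<close>

lemma swap_regs_compose:
  "swap_regs u v T \<circ> swap_regs u v T' = swap_regs u v (sym_diff T T')"
  by (auto simp: swap_regs_def fun_eq_iff)

lemma swap_regs_involutive [simp]: "swap_regs u v T (swap_regs u v T p) = p"
  by (auto simp: swap_regs_def split: prod.splits)

lemma swap_regs_in_iff:
  assumes "u \<in> V" "v \<in> V"
  shows "swap_regs u v T p \<in> V \<times> Ls \<longleftrightarrow> p \<in> V \<times> Ls"
  using assms by (cases p) (auto simp: swap_regs_def Transposition.transpose_def)

lemma comp_swap_regs_PiE:
  assumes "u \<in> V" "v \<in> V" and "x \<in> PiE (V \<times> Ls) (\<lambda>_. B)"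
  shows "x \<circ> swap_regs u v T \<in> PiE (V \<times> Ls) (\<lambda>_. B)"
proof (rule PiE_I)
  fix p
  show "(x \<circ> swap_regs u v T) p \<in> B" if "p \<in> V \<times> Ls"
    using that assms swap_regs_in_iff[OF assms(1,2)] by (metis PiE_mem comp_apply)
  show "(x \<circ> swap_regs u v T) p = undefined" if "p \<notin> V \<times> Ls"
    using that assms swap_regs_in_iff[OF assms(1,2)] by (metis PiE_arb comp_apply)
qed

lemma comp_swap_regs_twice [simp]: "x \<circ> swap_regs u v T \<circ> swap_regs u v T = x"
  by (simp add: fun_eq_iff)

lemma sum_comp_swap_regs:
  assumes "u \<in> V" "v \<in> V"
  shows "(\<Sum>x\<in>PiE (V \<times> Ls) (\<lambda>_. B). F (x \<circ> swap_regs u v T)) = (\<Sum>x\<in>PiE (V \<times> Ls) (\<lambda>_. B). F x)"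
  by (rule sum.reindex_bij_witness[where i = "\<lambda>x. x \<circ> swap_regs u v T" and j = "\<lambda>x. x \<circ> swap_regs u v T"])
    (use comp_swap_regs_PiE[OF assms, of _ Ls B T] in simp_all)

lemma ip_comp_swap_regs:
  assumes "u \<in> V" "v \<in> V"
  shows "ip (PiE (V \<times> Ls) (\<lambda>_. B)) (\<lambda>x. f (x \<circ> swap_regs u v T)) g =
    ip (PiE (V \<times> Ls) (\<lambda>_. B)) f (\<lambda>x. g (x \<circ> swap_regs u v T))"
  using sum_comp_swap_regs[OF assms, where T = T and F = "\<lambda>x. f x * g (x \<circ> swap_regs u v T)"]
  by (simp add: ip_def)

lemma ip_swap_test:
  "ip X f (swap_test u v J g) = (\<Sum>T\<in>Pow J. ip X f (\<lambda>x. g (x \<circ> swap_regs u v T))) / 2 ^ card J"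
  unfolding ip_def swap_test_def
  by (subst sum.swap) (simp add: sum_divide_distrib sum_distrib_left)

lemma ip_commute: "ip X f g = ip X g f"
  by (simp add: ip_def mult.commute)

text \<open>Composing with one swap of the group only permutes the swaps being averaged, via
  \<open>sym_diff T\<close>, so the second average is over equal terms.\<close>

lemma swap_test_idem:
  assumes "finite J"
  shows "swap_test u v J (swap_test u v J f) = swap_test u v J f"
proof
  fix x
  have eq: "(\<Sum>T'\<in>Pow J. f (x \<circ> swap_regs u v T \<circ> swap_regs u v T')) =
      (\<Sum>T'\<in>Pow J. f (x \<circ> swap_regs u v T'))" if "T \<in> Pow J" for T
    by (rule sum.reindex_bij_witness[where i = "sym_diff T" and j = "sym_diff T"])
      (use that in \<open>auto simp: comp_assoc swap_regs_compose\<close>)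
  have "swap_test u v J (swap_test u v J f) x =
      (\<Sum>T\<in>Pow J. (\<Sum>T'\<in>Pow J. f (x \<circ> swap_regs u v T')) / 2 ^ card J) / 2 ^ card J"
    unfolding swap_test_def using eq by (auto intro!: sum.cong arg_cong[where f = "\<lambda>z. z / _"])
  also have "\<dots> = swap_test u v J f x"
    using assms by (simp add: swap_test_def card_Pow)
  finally show "swap_test u v J (swap_test u v J f) x = swap_test u v J f x" .
qed

text \<open>Each swap is an involution permuting the basis, hence symmetric for \<open>ip\<close>,
  and so is the average.\<close>

lemma projector_swap_test:
  assumes "u \<in> V" "v \<in> V" "finite J"
  shows "projector (PiE (V \<times> Ls) (\<lambda>_. B)) (swap_test u v J)"
  unfolding projector_def
proof (intro conjI allI)
  let ?X = "PiE (V \<times> Ls) (\<lambda>_. B)"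
  show "linear_op (swap_test u v J)"
    by (simp add: linear_op_def swap_test_def fun_eq_iff sum.distrib sum_distrib_left add_divide_distrib)
  show adj: "ip ?X (swap_test u v J f) g = ip ?X f (swap_test u v J g)" for f g
  proof -
    have "ip ?X g (\<lambda>x. f (x \<circ> swap_regs u v T)) = ip ?X f (\<lambda>x. g (x \<circ> swap_regs u v T))" for T
      by (subst ip_commute) (rule ip_comp_swap_regs[OF assms(1,2)])
    then show ?thesis
      by (subst ip_commute) (simp only: ip_swap_test)
  qed
  show "ip ?X (swap_test u v J f) (swap_test u v J g) = ip ?X f (swap_test u v J g)" for f g
    using adj[of f "swap_test u v J g"] by (simp add: swap_test_idem[OF assms(3)])
qed

text \<open>Moves the permutation from the basis label to the register states by reindexing the
  product.\<close>

lemma product_state_swap: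
  assumes "u \<in> V" "v \<in> V" "x \<in> PiE (V \<times> Ls) (\<lambda>_. B)"
  shows "product_state (V \<times> Ls) B h (x \<circ> swap_regs u v T) =
    (\<Prod>r\<in>V \<times> Ls. h (swap_regs u v T r) (x r))"
proof -
  have "(\<Prod>r\<in>V \<times> Ls. h r (x (swap_regs u v T r))) = (\<Prod>r\<in>V \<times> Ls. h (swap_regs u v T r) (x r))"
    by (rule prod.reindex_bij_witness[where i = "swap_regs u v T" and j = "swap_regs u v T"])
      (use swap_regs_in_iff[OF assms(1,2), of T _ Ls] in simp_all)
  then show ?thesis
    using comp_swap_regs_PiE[OF assms] by (simp add: product_state_def)
qed

lemma swap_test_accepts:
  assumes "u \<in> V" "v \<in> V" "finite J" and "\<And>l. l \<in> J \<Longrightarrow> h (u, l) = h (v, l)"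
    and "x \<in> PiE (V \<times> Ls) (\<lambda>_. B)"
  shows "swap_test u v J (product_state (V \<times> Ls) B h) x = product_state (V \<times> Ls) B h x"
proof -
  have "h (swap_regs u v T r) = h r" if "T \<in> Pow J" for T r
    using that assms(4) by (cases r) (auto simp: swap_regs_def Transposition.transpose_def)
  then have "product_state (V \<times> Ls) B h (x \<circ> swap_regs u v T) = product_state (V \<times> Ls) B h x"
    if "T \<in> Pow J" for T
    unfolding product_state_swap[OF assms(1,2,5)] using that assms(5) by (simp add: product_state_def)
  then show ?thesis
    using assms(3) by (simp add: swap_test_def card_Pow)
qed

section \<open>Overlaps of a product state with its swapped versions\<close>

lemma ip_product_state:
  assumes "finite V" "finite Ls" "finite B" "u \<in> V" "v \<in> V"
  shows "ip (PiE (V \<times> Ls) (\<lambda>_. B)) (product_state (V \<times> Ls) B h)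
      (\<lambda>x. product_state (V \<times> Ls) B h (x \<circ> swap_regs u v T)) =
    (\<Prod>r\<in>V \<times> Ls. ip B (h r) (h (swap_regs u v T r)))"
proof -
  have "ip (PiE (V \<times> Ls) (\<lambda>_. B)) (product_state (V \<times> Ls) B h)
      (\<lambda>x. product_state (V \<times> Ls) B h (x \<circ> swap_regs u v T)) =
    (\<Sum>x\<in>PiE (V \<times> Ls) (\<lambda>_. B). \<Prod>r\<in>V \<times> Ls. h r (x r) * h (swap_regs u v T r) (x r))"
    unfolding ip_def prod.distrib
    by (intro sum.cong refl) (simp add: product_state_swap[OF assms(4,5)], simp add: product_state_def)
  also have "\<dots> = (\<Prod>r\<in>V \<times> Ls. ip B (h r) (h (swap_regs u v T r)))"
    unfolding ip_def using assms by (subst prod_sum_PiE) auto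
  finally show ?thesis .
qed

text \<open>In a swapped slot the registers of \<open>u\<close> and \<open>v\<close> each contribute
  their mutual overlap, hence the square; every untouched register contributes 1 by
  normalisation.\<close>

lemma ip_product_state_overlap:
  assumes "finite V" "finite Ls" "finite B" "u \<in> V" "v \<in> V" "u \<noteq> v" "T \<subseteq> Ls"
    and "\<And>r. r \<in> V \<times> Ls \<Longrightarrow> ip B (h r) (h r) = 1"
  shows "ip (PiE (V \<times> Ls) (\<lambda>_. B)) (product_state (V \<times> Ls) B h)
      (\<lambda>x. product_state (V \<times> Ls) B h (x \<circ> swap_regs u v T)) =
    (\<Prod>l\<in>T. (ip B (h (u, l)) (h (v, l)))\<^sup>2)"
proof -
  let ?G = "\<lambda>w l. ip B (h (w, l)) (h (swap_regs u v T (w, l)))"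
  have "(\<Prod>w\<in>V. ?G w l) = (if l \<in> T then (ip B (h (u, l)) (h (v, l)))\<^sup>2 else 1)" if l: "l \<in> Ls" for l
  proof (cases "l \<in> T")
    case True
    have "(\<Prod>w\<in>V. ?G w l) = (\<Prod>w\<in>{u, v}. ?G w l)"
      using assms l by (intro prod.mono_neutral_right) (auto simp: swap_regs_def Transposition.transpose_def)
    then show ?thesis
      using True assms(6) by (simp add: swap_regs_def power2_eq_square ip_commute[of B "h (v, l)"])
  next
    case False
    then show ?thesis using l assms(8) by (simp add: swap_regs_def)
  qed
  then have "(\<Prod>l\<in>Ls. \<Prod>w\<in>V. ?G w l) = (\<Prod>l\<in>T. (ip B (h (u, l)) (h (v, l)))\<^sup>2)"
    using assms(2,7) by (simp add: prod.inter_restrict[symmetric] Int_absorb1)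
  then show ?thesis
    unfolding ip_product_state[OF assms(1-5)]
    by (subst (asm) prod.swap) (simp add: prod.cartesian_product case_prod_unfold)
qed

lemma ip_product_state_self:
  assumes "finite R" "finite B" and "\<And>r. r \<in> R \<Longrightarrow> ip B (h r) (h r) = 1"
  shows "ip (PiE R (\<lambda>_. B)) (product_state R B h) (product_state R B h) = 1"
proof -
  have "ip (PiE R (\<lambda>_. B)) (product_state R B h) (product_state R B h) =
      (\<Sum>x\<in>PiE R (\<lambda>_. B). \<Prod>r\<in>R. h r (x r) * h r (x r))"
    by (simp add: ip_def product_state_def prod.distrib)
  also have "\<dots> = (\<Prod>r\<in>R. ip B (h r) (h r))"
    unfolding ip_def using assms(1,2) by (subst prod_sum_PiE) auto
  finally show ?thesis using assms(3) by simp
qed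

text \<open>The squared norm of the projection is the average over \<open>T\<close> of the overlaps.
  It factors into \<open>(1 + c l) / 2\<close> over the slots, where \<open>c l\<close> is the
  squared overlap, and each factor is at most \<open>(1 + 1/4) / 2 = 5/8\<close>.\<close>

lemma swap_test_rejects:
  assumes "finite V" "finite Ls" "finite B" "u \<in> V" "v \<in> V" "u \<noteq> v" "J \<subseteq> Ls"
    and "\<And>r. r \<in> V \<times> Ls \<Longrightarrow> ip B (h r) (h r) = 1"
    and "\<And>l. l \<in> J \<Longrightarrow> (ip B (h (u, l)) (h (v, l)))\<^sup>2 \<le> 1/4"
  shows "L2_set (swap_test u v J (product_state (V \<times> Ls) B h)) (PiE (V \<times> Ls) (\<lambda>_. B))
    \<le> sqrt ((5/8) ^ card J)"
proof -
  let ?X = "PiE (V \<times> Ls) (\<lambda>_. B)" and ?\<psi> = "product_state (V \<times> Ls) B h"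
  let ?c = "\<lambda>l. (ip B (h (u, l)) (h (v, l)))\<^sup>2"
  have J: "finite J" using assms finite_subset by blast
  have "ip ?X (swap_test u v J ?\<psi>) (swap_test u v J ?\<psi>) = ip ?X ?\<psi> (swap_test u v J ?\<psi>)"
    using projector_swap_test[OF assms(4,5) J, of Ls B] unfolding projector_def by blast
  also have "\<dots> = (\<Sum>T\<in>Pow J. \<Prod>l\<in>T. ?c l) / 2 ^ card J"
    unfolding ip_swap_test using assms
    by (intro arg_cong[where f = "\<lambda>z. z / _"] sum.cong refl ip_product_state_overlap) auto
  also have "(\<Sum>T\<in>Pow J. \<Prod>l\<in>T. ?c l) = (\<Prod>l\<in>J. ?c l + 1)"
    by (subst prod_add[OF J]) simp
  also have "\<dots> \<le> (\<Prod>l\<in>J. 5/4)"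
    using assms(9) by (intro prod_mono) (auto intro: add_nonneg_nonneg)
  finally have "ip ?X (swap_test u v J ?\<psi>) (swap_test u v J ?\<psi>) \<le> (5/4) ^ card J / 2 ^ card J"
    by (simp add: divide_right_mono)
  also have "\<dots> = (5/8) ^ card J"
    by (simp add: power_divide[symmetric])
  finally show ?thesis by (simp add: L2_set_ip)
qed

section \<open>Fingerprints\<close>

text \<open>The character \<open>(-1)^|r Int U|\<close> of the group of subsets of
  \<open>{..<k}\<close> under symmetric difference, with elements from \<open>k\<close> on
  ignored.\<close>

definition char_sign :: "nat \<Rightarrow> nat set \<Rightarrow> nat set \<Rightarrow> real" where
  "char_sign k r U = (\<Prod>i<k. if i \<in> r \<and> i \<in> U then - 1 else 1)"

lemma char_sign_commute: "char_sign k r U = char_sign k U r"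
  by (simp add: char_sign_def conj_commute)

lemma char_sign_mult: "char_sign k r S * char_sign k r S' = char_sign k r (sym_diff S S')"
  unfolding char_sign_def prod.distrib[symmetric] by (intro prod.cong) auto

lemma char_sign_square [simp]: "char_sign k r S * char_sign k r S = 1"
  by (simp add: char_sign_mult) (simp add: char_sign_def)

lemma char_sign_singleton:
  assumes "e < k" "e \<in> U"
  shows "char_sign k {e} U = - 1"
proof -
  have "char_sign k {e} U = (\<Prod>i<k. if i = e then - 1 else 1)"
    unfolding char_sign_def using assms by (intro prod.cong) auto
  then show ?thesis using assms by simp
qed

text \<open>Toggling an element \<open>e\<close> of \<open>U\<close> in \<open>r\<close> flips the
  sign, so both signs of \<open>s\<close> give the same sum; the values 2 and 1/2 average to
  5/4.\<close>

lemma sum_powr_char_sign: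
  assumes "U \<subseteq> {..<k}" "U \<noteq> {}" and s: "s = 1 \<or> s = - 1"
  shows "(\<Sum>r\<in>Pow {..<k}. 2 powr (s * char_sign k r U)) = 2 ^ k * (5/4)"
proof -
  obtain e where e: "e \<in> U" "e < k" using assms by auto
  have flip: "char_sign k (sym_diff r {e}) U = - char_sign k r U" for r
    using char_sign_mult[of k U r "{e}"] char_sign_singleton[OF e(2,1)]
    by (simp add: char_sign_commute[of k _ U])
  let ?F = "\<lambda>s. \<Sum>r\<in>Pow {..<k}. 2 powr (s * char_sign k r U)"
  have "?F s = ?F (- s)"
    by (rule sum.reindex_bij_witness[where i = "\<lambda>r. sym_diff r {e}" and j = "\<lambda>r. sym_diff r {e}"])
      (use e flip in auto)
  moreover have "?F s + ?F (- s) = (\<Sum>r\<in>Pow {..<k}. 5/2)"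
    unfolding sum.distrib[symmetric]
  proof (intro sum.cong refl)
    fix r
    have "char_sign k r U = 1 \<or> char_sign k r U = - 1"
      using char_sign_square[of k r U] by (metis square_eq_1_iff)
    with s show "2 powr (s * char_sign k r U) + 2 powr (- s * char_sign k r U) = 5/2"
      by (auto simp: powr_minus)
  qed
  ultimately show ?thesis by (simp add: card_Pow)
qed

text \<open>The rows come from the probabilistic method: averaging the moment generating function
  at base 2 over all choices of rows replaces the Chernoff bound.\<close>

lemma small_bias_rows:
  assumes "4 * (k + 1) \<le> N"
  obtains \<rho> where "\<And>U. U \<subseteq> {..<k} \<Longrightarrow> U \<noteq> {} \<Longrightarrow> \<bar>\<Sum>a<2 * N. char_sign k (\<rho> a) U\<bar> \<le> real N"
proof -
  define Us where "Us = Pow {..<k} - {{}}"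
  define \<Omega> where "\<Omega> = PiE {..<2 * N} (\<lambda>_. Pow {..<k})"
  define Z where "Z \<rho> U = (\<Sum>a<2 * N. char_sign k (\<rho> a) U)" for \<rho> :: "nat \<Rightarrow> nat set" and U
  \<comment> \<open>Both signs are included so that one bound on \<open>W\<close> controls the
    absolute bias of every nonempty \<open>U\<close> at once, in place of a union bound.\<close>
  define W where "W \<rho> = (\<Sum>U\<in>Us. 2 powr (Z \<rho> U) + 2 powr (- Z \<rho> U))" for \<rho>
  have fin: "finite \<Omega>" "finite Us" unfolding \<Omega>_def Us_def by (auto intro: finite_PiE)
  have mgf: "(\<Sum>\<rho>\<in>\<Omega>. 2 powr (s * Z \<rho> U)) = (2 ^ k * (5/4)) ^ (2 * N)"
    if "U \<in> Us" "s = 1 \<or> s = - 1" for s U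
  proof -
    have "(\<Sum>\<rho>\<in>\<Omega>. 2 powr (s * Z \<rho> U)) = (\<Sum>\<rho>\<in>\<Omega>. \<Prod>a<2 * N. 2 powr (s * char_sign k (\<rho> a) U))"
      by (simp add: Z_def sum_distrib_left powr_sum)
    also have "\<dots> = (\<Prod>a<2 * N. \<Sum>r\<in>Pow {..<k}. 2 powr (s * char_sign k r U))"
      unfolding \<Omega>_def by (subst prod_sum_PiE) auto
    also have "\<dots> = (2 ^ k * (5/4)) ^ (2 * N)"
      using sum_powr_char_sign[of U k s] that
      by (simp only: Us_def Diff_iff Pow_iff singleton_iff prod_constant card_lessThan not_False_eq_True simp_thms)
    finally show ?thesis .
  qed
  have "(\<Sum>\<rho>\<in>\<Omega>. W \<rho>) = (\<Sum>U\<in>Us. 2 * (2 ^ k * (5/4)) ^ (2 * N))"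
    unfolding W_def using mgf[of _ 1] mgf[of _ "- 1"]
    by (subst sum.swap) (auto simp: sum.distrib intro!: sum.cong)
  also have "\<dots> = real (card Us) * (2 * (2 ^ k * (5/4)) ^ (2 * N))"
    by simp
  \<comment> \<open>Strict because the empty set is excluded from \<open>Us\<close>.\<close>
  also have "\<dots> < 2 ^ k * (2 * (2 ^ k * (5/4)) ^ (2 * N))"
  proof -
    have "card Us < card (Pow {..<k})"
      unfolding Us_def by (intro psubset_card_mono) auto
    then have "real (card Us) < real (card (Pow {..<k}))"
      by (simp only: of_nat_less_iff)
    then have "real (card Us) < 2 ^ k"
      by (simp add: card_Pow)
    then show ?thesis by (intro mult_strict_right_mono) auto
  qed
  also have "\<dots> = (\<Sum>\<rho>\<in>\<Omega>. 2 ^ (k + 1) * (5/4) ^ (2 * N))"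
    by (simp add: \<Omega>_def card_PiE card_Pow power_mult_distrib power_divide)
  finally have lt: "(\<Sum>\<rho>\<in>\<Omega>. W \<rho>) < (\<Sum>\<rho>\<in>\<Omega>. 2 ^ (k + 1) * (5/4) ^ (2 * N))" .
  obtain \<rho> where \<rho>: "W \<rho> < 2 ^ (k + 1) * (5/4) ^ (2 * N)"
  proof (rule ccontr)
    assume "\<not> thesis"
    then have "2 ^ (k + 1) * (5/4) ^ (2 * N) \<le> W \<rho>" for \<rho>
      using that not_le by blast
    then have "(\<Sum>\<rho>\<in>\<Omega>. 2 ^ (k + 1) * (5/4) ^ (2 * N)) \<le> (\<Sum>\<rho>\<in>\<Omega>. W \<rho>)"
      by (intro sum_mono)
    with lt show False by simp
  qed
  \<comment> \<open>Split \<open>2 = (32/25) * (25/16)\<close>, where \<open>25/16\<close> is the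
    square of \<open>5/4\<close>. As \<open>(32/25)^4\<close> exceeds 2, the
    \<open>N >= 4 * (k + 1)\<close> factors \<open>32/25\<close> absorb
    \<open>2 ^ (k + 1)\<close>.\<close>
  have small: "2 ^ (k + 1) * (5/4) ^ (2 * N) \<le> (2::real) powr real N"
  proof -
    have "(2::real) ^ (k + 1) \<le> ((32/25) ^ 4) ^ (k + 1)"
      by (intro power_mono) (auto simp: power4_eq_xxxx)
    also have "\<dots> \<le> (32/25) ^ N"
      unfolding power_mult[symmetric] using assms by (intro power_increasing) auto
    finally have "(2::real) ^ (k + 1) * (25/16) ^ N \<le> (32/25) ^ N * (25/16) ^ N"
      by (intro mult_right_mono) auto
    also have "\<dots> = 2 ^ N"
      unfolding power_mult_distrib[symmetric] by simp
    finally show ?thesis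
      by (simp add: powr_realpow power_mult power2_eq_square)
  qed
  show thesis
  proof (rule that[of \<rho>])
    fix U assume "U \<subseteq> {..<k}" "U \<noteq> {}"
    then have "U \<in> Us" by (simp add: Us_def)
    then have "2 powr (Z \<rho> U) + 2 powr (- Z \<rho> U) \<le> W \<rho>"
      unfolding W_def using fin by (intro member_le_sum) auto
    with \<rho> small have lt: "2 powr (Z \<rho> U) + 2 powr (- Z \<rho> U) < 2 powr real N" by linarith
    have "2 powr (Z \<rho> U) < 2 powr real N"
      using lt powr_ge_zero[of 2 "- Z \<rho> U"] by linarith
    moreover have "2 powr (- Z \<rho> U) < 2 powr real N"
      using lt powr_ge_zero[of 2 "Z \<rho> U"] by linarith
    ultimately have "\<bar>Z \<rho> U\<bar> \<le> real N" by simp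
    then show "\<bar>\<Sum>a<2 * N. char_sign k (\<rho> a) U\<bar> \<le> real N"
      by (simp add: Z_def)
  qed
qed

text \<open>Scaled sign vectors: the overlap of \<open>S\<close> and \<open>S'\<close> is the
  normalised bias of their symmetric difference, nonempty for distinct sets, and bias
  \<open>N\<close> out of \<open>2 * N\<close> rows means overlap at most 1/2.\<close>

lemma fingerprints_exist:
  assumes "4 * (k + 1) \<le> N"
  obtains h :: "nat set \<Rightarrow> nat \<Rightarrow> real" where
    "\<And>S. ip {..<2 * N} (h S) (h S) = 1"
    "\<And>S S'. S \<subseteq> {..<k} \<Longrightarrow> S' \<subseteq> {..<k} \<Longrightarrow> S \<noteq> S' \<Longrightarrow> (ip {..<2 * N} (h S) (h S'))\<^sup>2 \<le> 1/4"
proof -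
  obtain \<rho> where \<rho>: "\<And>U. U \<subseteq> {..<k} \<Longrightarrow> U \<noteq> {} \<Longrightarrow> \<bar>\<Sum>a<2 * N. char_sign k (\<rho> a) U\<bar> \<le> real N"
    using small_bias_rows[OF assms] by blast
  have N: "N > 0" using assms by simp
  define h where "h S a = char_sign k (\<rho> a) S / sqrt (2 * N)" for S a
  have ip: "ip {..<2 * N} (h S) (h S') = (\<Sum>a<2 * N. char_sign k (\<rho> a) (sym_diff S S')) / (2 * N)" for S S'
    by (simp add: ip_def h_def char_sign_mult sum_divide_distrib)
  show thesis
  proof (rule that[of h])
    show "ip {..<2 * N} (h S) (h S) = 1" for S
      using N by (simp add: ip) (simp add: char_sign_def)
    fix S S' assume "S \<subseteq> {..<k}" "S' \<subseteq> {..<k}" "S \<noteq> S'"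
    then have "\<bar>\<Sum>a<2 * N. char_sign k (\<rho> a) (sym_diff S S')\<bar> \<le> real N"
      by (intro \<rho>) auto
    then have "\<bar>ip {..<2 * N} (h S) (h S')\<bar> \<le> 1/2"
      unfolding ip using N by (simp add: divide_le_eq)
    then have "\<bar>ip {..<2 * N} (h S) (h S')\<bar>\<^sup>2 \<le> (1/2)\<^sup>2"
      by (intro power_mono) auto
    then show "(ip {..<2 * N} (h S) (h S'))\<^sup>2 \<le> 1/4"
      by (simp add: power2_eq_square)
  qed
qed

section \<open>The protocol\<close>

text \<open>The referee evaluates this on whatever relation the accepted tests describe, transitive or not.\<close>

definition min_partition :: "nat \<Rightarrow> (nat \<Rightarrow> nat \<Rightarrow> bool) \<Rightarrow> nat" where
  "min_partition k W = (LEAST d. \<exists>P. partition_on {..<k} P \<and> card P = d \<and>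
      (\<forall>S\<in>P. \<forall>u\<in>S. \<forall>v\<in>S. u \<noteq> v \<longrightarrow> W u v))"

lemma min_partition_cong:
  assumes "\<And>u v. u < k \<Longrightarrow> v < k \<Longrightarrow> u \<noteq> v \<Longrightarrow> W u v = W' u v"
  shows "min_partition k W = min_partition k W'"
proof -
  have "(\<forall>S\<in>P. \<forall>u\<in>S. \<forall>v\<in>S. u \<noteq> v \<longrightarrow> W u v) = (\<forall>S\<in>P. \<forall>u\<in>S. \<forall>v\<in>S. u \<noteq> v \<longrightarrow> W' u v)"
    if "partition_on {..<k} P" for P
  proof -
    have lt: "w < k" if "S \<in> P" "w \<in> S" for S w
      using partition_onD1[OF \<open>partition_on {..<k} P\<close>] that by blast
    show ?thesis
      by (intro ball_cong refl imp_cong assms lt)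
  qed
  then show ?thesis
    unfolding min_partition_def by (simp cong: conj_cong)
qed

text \<open>Singletons satisfy any relation vacuously, so even inconsistent test answers yield an
  output in \<open>{..k}\<close>.\<close>

lemma min_partition_le: "min_partition k W \<le> k"
  unfolding min_partition_def
proof (rule Least_le, intro exI conjI)
  show "partition_on {..<k} ((\<lambda>u. {u}) ` {..<k})"
    by (auto simp: partition_on_def disjoint_def)
  show "card ((\<lambda>u. {u}) ` {..<k}) = k"
    by (simp add: card_image)
qed auto

text \<open>The adjacency conditions are automatic: equal open neighbourhoods exclude an edge by
  irreflexivity, and equal closed ones force it. What remains are equalities between sets each known
  to one player.\<close>

lemma twins_iff:
  assumes "is_graph k E" "u < k" "v < k" "u \<noteq> v"
  shows "twins k E u v \<longleftrightarrow>
    nbhd k E u = nbhd k E v \<or> insert u (nbhd k E u) = insert v (nbhd k E v)"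
proof -
  have irr: "\<not> E w w" for w
    using assms(1) by (simp add: is_graph_def)
  have "\<not> E u v" if "nbhd k E u = nbhd k E v"
    using that irr assms(3) unfolding nbhd_def by blast
  moreover have "E u v" if "insert u (nbhd k E u) = insert v (nbhd k E v)"
  proof -
    have "v \<in> insert u (nbhd k E u)" using that by simp
    then show ?thesis using assms(4) by (simp add: nbhd_def)
  qed
  ultimately show ?thesis
    using assms(4) by (auto simp: twins_def false_twins_def true_twins_def)
qed

text \<open>Parameters stay open: \<open>m\<close> qubits per fingerprint and \<open>t\<close>
  copies of each kind. The last hypothesis bounds the accumulated error of the
  \<open>2 * k^2\<close> tests.\<close>

lemma protocol_exists:
  assumes N: "4 * (k + 1) \<le> N" and m: "2 * N = 2 ^ m"
    and t: "real (2 * k\<^sup>2) * sqrt ((5/8) ^ t) \<le> 1/6"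
  shows "\<exists>\<sigma> M. qnih_protocol k (\<lambda>_. m * (2 * t)) \<sigma> (Suc k) M \<and>
    (\<forall>E. is_graph k E \<longrightarrow> output_prob k \<sigma> (Suc k) M E (neighborhood_diversity k E) \<ge> 2/3)"
proof -
  obtain h :: "nat set \<Rightarrow> nat \<Rightarrow> real" where
    h1: "\<And>S. ip {..<2 * N} (h S) (h S) = 1" and
    h2: "\<And>S S'. S \<subseteq> {..<k} \<Longrightarrow> S' \<subseteq> {..<k} \<Longrightarrow> S \<noteq> S' \<Longrightarrow> (ip {..<2 * N} (h S) (h S'))\<^sup>2 \<le> 1/4"
    using fingerprints_exist[OF N] by blast
  define B where "B = (2::nat) ^ m"
  define L where "L = 2 * t"
  define D where "D = (B ^ L) ^ k"
  have B0: "0 < B" "0 < B ^ L" by (simp_all add: B_def)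
  have BN: "2 * N = B" using m by (simp add: B_def)
  have dims: "2 ^ (m * (2 * t)) = B ^ L" "2 ^ (\<Sum>v<k. m * (2 * t)) = D"
    by (simp_all add: B_def L_def D_def power_mult[symmetric] mult_ac)
  \<comment> \<open>Only the labelling is used here: splitting a message into registers is a choice
    of coordinates, whereas \<open>dec\<close> must agree with the Kronecker product of the
    messages.\<close>
  obtain dl :: "nat \<Rightarrow> nat \<Rightarrow> nat" where
    dl: "bij_betw dl {..<B ^ L} (PiE {..<L} (\<lambda>_. {..<B}))"
    using kron_index_bij[OF B0(1), of L] by blast
  obtain dec :: "nat \<Rightarrow> nat \<Rightarrow> nat" where
    dec: "bij_betw dec {..<D} (PiE {..<k} (\<lambda>_. {..<B ^ L}))" and
    kron: "\<And>A. (\<And>v. v < k \<Longrightarrow> A v \<in> carrier_mat (B ^ L) (B ^ L)) \<Longrightarrow>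
      kron_list (map A [0..<k]) = mat D D (\<lambda>(i, j). \<Prod>v<k. A v $$ (dec i v, dec j v))"
    using kron_index_bij[OF B0(2), of k] unfolding D_def by blast
  define R where "R = {..<k} \<times> {..<L}"
  define X where "X = PiE R (\<lambda>_. {..<B})"
  define co where "co i = restrict (\<lambda>(v, l). dl (dec i v) l) R" for i
  have co: "bij_betw co {..<D} X"
    using nested_index_bij[OF dec[unfolded D_def] dl] unfolding co_def R_def X_def D_def .
  have X: "finite X" using bij_betw_finite[OF co] by simp

  \<comment> \<open>Registers below \<open>t\<close> carry the open neighbourhood, the others the closed one.\<close>
  define nb where "nb v S l = (if l < t then S else insert v S)" for v :: nat and S and l :: nat
  define \<phi> where "\<phi> v S i = product_state {..<L} {..<B} (\<lambda>l. h (nb v S l)) (dl i)" for v S i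
  define \<sigma> where "\<sigma> v S = pure_state (B ^ L) (\<phi> v S)" for v S
  \<comment> \<open>Ordered pairs including the diagonal, where the test acts as the identity; the
    flag \<open>True\<close> selects closed neighbourhoods.\<close>
  define tests where "tests = {..<k} \<times> {..<k} \<times> (UNIV :: bool set)"
  have "finite tests" by (simp add: tests_def)
  then obtain ts where ts: "set ts = tests" "distinct ts"
    using finite_distinct_list by blast
  have len: "length ts = 2 * k\<^sup>2"
    using distinct_card[OF ts(2)] unfolding ts(1)
    by (simp add: tests_def card_cartesian_product power2_eq_square)
  define J where "J c = (if c then {t..<L} else {..<t})" for c
  define P where "P = (\<lambda>(u, v, c). swap_test u v (J c) :: ((nat \<times> nat \<Rightarrow> nat) \<Rightarrow> real) \<Rightarrow> _)"
  define K where "K A = seq_meas P ts A" for A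
  define out where "out A = min_partition k (\<lambda>u v. (u, v, False) \<in> A \<or> (u, v, True) \<in> A)" for A
  define M where "M r = effect D co X {A \<in> Pow tests. out A = r} K" for r
  have J: "finite (J c)" "card (J c) = t" "J c \<subseteq> {..<L}" for c
    by (auto simp: J_def L_def)
  have proj: "projector X (P p)" if "p \<in> set ts" for p
    using that J unfolding ts(1) tests_def P_def X_def R_def
    by (auto intro: projector_swap_test)
  have lin: "linear_op (K A)" for A
    unfolding K_def by (rule linear_op_seq_meas) (use proj in \<open>simp add: projector_def\<close>)

  have "density_op (B ^ L) (\<sigma> v S)" for v S
  proof -
    let ?f = "product_state {..<L} {..<B} (\<lambda>l. h (nb v S l))"
    have "(\<Sum>i<B ^ L. (\<phi> v S i)\<^sup>2) = (\<Sum>x\<in>PiE {..<L} (\<lambda>_. {..<B}). (?f x)\<^sup>2)"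
      unfolding \<phi>_def by (rule sum.reindex_bij_betw[OF dl])
    also have "\<dots> = ip (PiE {..<L} (\<lambda>_. {..<B})) ?f ?f"
      by (simp add: ip_def power2_eq_square)
    also have "\<dots> = 1"
      using h1 unfolding BN by (intro ip_product_state_self) auto
    finally show ?thesis
      unfolding \<sigma>_def by (rule density_op_pure_state)
  qed
  moreover have "povm D (Suc k) M"
    unfolding M_def
  proof (rule povm_effect[OF co])
    show "out A < Suc k" for A
      using min_partition_le by (simp add: out_def le_imp_less_Suc)
    show "(\<Sum>A\<in>Pow tests. ip X (K A f) (K A g)) = ip X f g" for f g
      using seq_meas_complete[OF ts(2) proj] unfolding K_def ts(1) by simp
  qed (simp add: tests_def)
  ultimately have protocol: "qnih_protocol k (\<lambda>_. m * (2 * t)) \<sigma> (Suc k) M"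
    by (simp only: qnih_protocol_def dims) simp

  have "2/3 \<le> output_prob k \<sigma> (Suc k) M E (neighborhood_diversity k E)" if E: "is_graph k E" for E
  proof -
    define nE where "nE = nbhd k E"
    define hE where "hE = (\<lambda>(v, l). h (nb v (nE v) l))"
    define f where "f = product_state R {..<B} hE"
    \<comment> \<open>The outcome record in which every test answers correctly.\<close>
    define AE where "AE = {p \<in> tests. case p of (u, v, c) \<Rightarrow>
      if c then insert u (nE u) = insert v (nE v) else nE u = nE v}"
    have nE: "nE v \<subseteq> {..<k}" for v by (auto simp: nE_def nbhd_def)
    have hE1: "ip {..<B} (hE r) (hE r) = 1" for r
      using h1 unfolding BN by (cases r) (simp add: hE_def)
    have nb_sub: "nb v (nE v) l \<subseteq> {..<k}" if "v < k" for v l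
      using nE[of v] that by (auto simp: nb_def)

    have "joint_state k \<sigma> E = mat D D (\<lambda>(i, j). \<Prod>v<k. \<sigma> v (nE v) $$ (dec i v, dec j v))"
      unfolding joint_state_def nE_def by (rule kron) (simp add: \<sigma>_def pure_state_def)
    \<comment> \<open>A Kronecker product of rank-one states is rank one, and its amplitudes in the
      coordinates \<open>co\<close> are the product state over all registers.\<close>
    also have "\<dots> = pure_state D (\<lambda>i. f (co i))"
    proof (rule eq_matI)
      fix i j assume "i < dim_row (pure_state D (\<lambda>i. f (co i)))" "j < dim_col (pure_state D (\<lambda>i. f (co i)))"
      then have ij: "i < D" "j < D" by (simp_all add: pure_state_def)
      have lt: "dec i v < B ^ L" if "i < D" "v < k" for i v
        using bij_betwE[OF dec] that by (auto dest: PiE_mem)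
      have f: "f (co i) = (\<Prod>v<k. \<phi> v (nE v) (dec i v))" if "i < D" for i
      proof -
        have "f (co i) = (\<Prod>r\<in>R. hE r (co i r))"
          using bij_betwE[OF co] that by (simp add: f_def product_state_def X_def)
        also have "\<dots> = (\<Prod>(v, l)\<in>R. h (nb v (nE v) l) (dl (dec i v) l))"
          by (intro prod.cong) (auto simp: co_def hE_def)
        also have "\<dots> = (\<Prod>v<k. \<Prod>l<L. h (nb v (nE v) l) (dl (dec i v) l))"
          unfolding R_def by (rule prod.cartesian_product[symmetric])
        also have "\<dots> = (\<Prod>v<k. \<phi> v (nE v) (dec i v))"
          using bij_betwE[OF dl] lt[OF that]
          by (intro prod.cong) (simp_all add: \<phi>_def product_state_def)
        finally show ?thesis .
      qed
      show "mat D D (\<lambda>(i, j). \<Prod>v<k. \<sigma> v (nE v) $$ (dec i v, dec j v)) $$ (i, j) =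
          pure_state D (\<lambda>i. f (co i)) $$ (i, j)"
        using ij lt[OF ij(1)] lt[OF ij(2)]
        by (simp add: pure_state_def \<sigma>_def f prod.distrib)
    qed (simp_all add: pure_state_def)
    finally have joint: "joint_state k \<sigma> E = pure_state D (\<lambda>i. f (co i))" .

    have expand: "f x = (\<Sum>i<D. f (co i) * delta (co i) x)" for x
    proof -
      have "(\<Sum>i<D. f (co i) * delta (co i) x) = (\<Sum>y\<in>X. f y * delta y x)"
        by (rule sum.reindex_bij_betw[OF co])
      also have "\<dots> = (\<Sum>y\<in>X. if y = x then f y else 0)"
        by (intro sum.cong) (auto simp: delta_def)
      also have "\<dots> = f x"
        using X by (simp add: f_def product_state_def X_def)
      finally show ?thesis by simp
    qed

    have "out AE = neighborhood_diversity k E"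
      unfolding out_def neighborhood_diversity_def min_partition_def[symmetric]
      by (rule min_partition_cong) (simp add: twins_iff[OF E] AE_def tests_def nE_def)
    then have AE: "AE \<in> {A \<in> Pow tests. out A = neighborhood_diversity k E}"
      by (auto simp: AE_def)

    have acc: "L2_set (\<lambda>x. f x - P p f x) X \<le> sqrt ((5/8) ^ t)" if "p \<in> set ts" "p \<in> AE" for p
    proof -
      obtain u v c where p: "p = (u, v, c)" by (cases p)
      have uv: "u \<in> {..<k}" "v \<in> {..<k}" using that p by (auto simp: ts tests_def)
      have "hE (u, l) = hE (v, l)" if "l \<in> J c" for l
        using \<open>p \<in> AE\<close> that by (auto simp: AE_def p hE_def nb_def J_def split: if_splits)
      then have "P p f x = f x" if "x \<in> X" for x
        using that J uv swap_test_accepts[OF uv J(1)[of c], of hE x "{..<L}" "{..<B}"]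
        by (simp add: P_def p f_def R_def X_def)
      \<comment> \<open>Acceptance of equal sets is exact; only tests on distinct sets cause
        error.\<close>
      then have "L2_set (\<lambda>x. f x - P p f x) X = 0"
        by (simp add: L2_set_def)
      then show ?thesis by simp
    qed
    have rej: "L2_set (P p f) X \<le> sqrt ((5/8) ^ t)" if "p \<in> set ts" "p \<notin> AE" for p
    proof -
      obtain u v c where p: "p = (u, v, c)" by (cases p)
      have uv: "u \<in> {..<k}" "v \<in> {..<k}" using that p by (auto simp: ts tests_def)
      have ne: "nb u (nE u) l \<noteq> nb v (nE v) l" if "l \<in> J c" for l
        using \<open>p \<notin> AE\<close> that uv by (auto simp: AE_def p nb_def J_def tests_def split: if_splits)
      \<comment> \<open>Diagonal tests belong to \<open>AE\<close>, so a rejecting one compares two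
        different players.\<close>
      have "u \<noteq> v"
        using \<open>p \<notin> AE\<close> uv by (auto simp: AE_def p tests_def split: if_splits)
      moreover have "(ip {..<B} (hE (u, l)) (hE (v, l)))\<^sup>2 \<le> 1/4" if "l \<in> J c" for l
        using h2[OF nb_sub nb_sub ne[OF that]] uv unfolding BN by (simp add: hE_def)
      ultimately have "L2_set (swap_test u v (J c) f) X \<le> sqrt ((5/8) ^ card (J c))"
        unfolding f_def X_def R_def using uv J(3) hE1 by (intro swap_test_rejects) auto
      then show ?thesis by (simp add: P_def p J(2))
    qed
    have "ip X f f = 1"
      unfolding f_def X_def using hE1 by (intro ip_product_state_self) (auto simp: R_def)
    then have "(1 - real (length ts) * sqrt ((5/8) ^ t))\<^sup>2 \<le> ip X (K AE f) (K AE f)"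
      unfolding K_def using proj acc rej t by (intro seq_meas_prob) (auto simp: len)
    \<comment> \<open>This is 25/36, just above 2/3.\<close>
    moreover have "(5/6)\<^sup>2 \<le> (1 - real (length ts) * sqrt ((5/8) ^ t))\<^sup>2"
      using t unfolding len by (intro power_mono) linarith+
    \<comment> \<open>Other records leading to the same output can only add probability.\<close>
    moreover have "ip X (K AE f) (K AE f) \<le>
        (\<Sum>A\<in>{A \<in> Pow tests. out A = neighborhood_diversity k E}. ip X (K A f) (K A f))"
      using \<open>finite tests\<close> by (intro member_le_sum[OF AE] ip_self_nonneg) auto
    moreover have "output_prob k \<sigma> (Suc k) M E (neighborhood_diversity k E) =
        (\<Sum>A\<in>{A \<in> Pow tests. out A = neighborhood_diversity k E}. ip X (K A f) (K A f))"
    proof -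
      have "neighborhood_diversity k E < Suc k"
        using min_partition_le unfolding neighborhood_diversity_def min_partition_def[symmetric]
        by (simp add: le_imp_less_Suc)
      moreover have "mtrace (M (neighborhood_diversity k E) * pure_state D (\<lambda>i. f (co i))) =
          of_real (\<Sum>A\<in>{A \<in> Pow tests. out A = neighborhood_diversity k E}. ip X (K A f) (K A f))"
        unfolding M_def
      proof (rule mtrace_effect[OF X])
        show "finite {A \<in> Pow tests. out A = neighborhood_diversity k E}"
          using \<open>finite tests\<close> by simp
      qed (rule lin, rule expand)
      ultimately show ?thesis
        by (simp add: output_prob_def joint)
    qed
    ultimately show ?thesis by (simp add: power2_eq_square)
  qed
  with protocol show ?thesis by blast
qed

theorem theorem9:
  shows "\<exists>C :: real. \<forall>k :: nat. k \<ge> 2 \<longrightarrow>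
    (\<exists>q \<sigma> m M. qnih_protocol k q \<sigma> m M \<and>
       real (qnih_cost k q) \<le> C * real k * (log 2 (real k))^2 \<and>
       (\<forall>E. is_graph k E \<longrightarrow>
          output_prob k \<sigma> m M E (neighborhood_diversity k E) \<ge> 2/3))"
\<comment> \<open>With \<open>b + 4 <= 5 * b\<close>, \<open>2 * t <= 48 * b\<close> and
  \<open>b <= 2 * log 2 k\<close>, the cost per player is at most \<open>5 * 48 * 4 = 960\<close>
  times the squared logarithm.\<close>
proof (intro exI[of _ 960] allI impI)
  fix k :: nat assume k: "2 \<le> k"
  define b where "b = nat \<lceil>log 2 (real k)\<rceil>"
  have log1: "1 \<le> log 2 (real k)" using k by simp
  \<comment> \<open>Rounding up adds less than 1, which is at most the logarithm itself since
    \<open>k >= 2\<close>.\<close>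
  have b1: "1 \<le> b" and b2: "real b \<le> 2 * log 2 (real k)" and b3: "log 2 (real k) \<le> real b"
    using log1 unfolding b_def by linarith+
  have kb: "real k \<le> 2 ^ b"
    using b3 k by (simp add: log_le_iff powr_realpow)
  then have "real k \<le> real (2 ^ b)"
    by simp
  then have kb': "k \<le> 2 ^ b"
    by (simp only: of_nat_le_iff)
  \<comment> \<open>A power of two, so that a fingerprint fills exactly \<open>b + 4\<close> qubits;
    \<open>8 * 2 ^ b\<close> is at least \<open>4 * (k + 1)\<close>.\<close>
  define N where "N = (2::nat) ^ (b + 3)"
  \<comment> \<open>As \<open>(5/8)^2 <= 1/2\<close>, the power \<open>(5/8) ^ t\<close> is at most
    \<open>(1/2) ^ (8 + 4 * b)\<close>: the part \<open>4 * b\<close> cancels \<open>k ^ 4\<close>,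
    and the part 8 leaves \<open>4 / 256 = 1/64\<close> for the squared error.\<close>
  define t where "t = 16 + 8 * b"
  have N: "4 * (k + 1) \<le> N" and m: "2 * N = 2 ^ (b + 4)"
    using kb' k by (simp_all add: N_def power_add)
  have "(real (2 * k\<^sup>2) * sqrt ((5/8) ^ t))\<^sup>2 = 4 * real k ^ 4 * (5/8) ^ t"
    by (simp add: power_mult_distrib)
  also have "\<dots> \<le> 4 * (2 ^ b) ^ 4 * (1/2) ^ (8 + 4 * b)"
  proof (intro mult_mono power_mono kb)
    have "t = 2 * (8 + 4 * b)" by (simp add: t_def)
    then have "(5/8 :: real) ^ t = ((5/8)\<^sup>2) ^ (8 + 4 * b)"
      by (simp only: power_mult)
    also have "\<dots> \<le> (1/2 :: real) ^ (8 + 4 * b)"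
      by (intro power_mono) (auto simp: power2_eq_square)
    finally show "(5/8) ^ t \<le> (1/2 :: real) ^ (8 + 4 * b)" .
  qed auto
  also have "\<dots> = 1/64"
    by (simp add: power_add power_mult[symmetric] power_divide mult.commute)
  also have "\<dots> \<le> (1/6)\<^sup>2"
    by (simp add: power2_eq_square)
  finally have "real (2 * k\<^sup>2) * sqrt ((5/8) ^ t) \<le> 1/6"
    by (rule power2_le_imp_le) simp
  from protocol_exists[OF N m this] obtain \<sigma> M where
    "qnih_protocol k (\<lambda>_. (b + 4) * (2 * t)) \<sigma> (Suc k) M"
    "\<forall>E. is_graph k E \<longrightarrow> output_prob k \<sigma> (Suc k) M E (neighborhood_diversity k E) \<ge> 2/3"
    by blast
  moreover have "real (qnih_cost k (\<lambda>_. (b + 4) * (2 * t))) \<le> 960 * real k * (log 2 (real k))\<^sup>2"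
  proof -
    have "(b + 4) * (2 * t) \<le> (5 * b) * (48 * b)"
      by (rule mult_mono) (use b1 in \<open>auto simp: t_def\<close>)
    then have "real ((b + 4) * (2 * t)) \<le> real ((5 * b) * (48 * b))"
      by (simp only: of_nat_le_iff)
    also have "\<dots> = 240 * (real b)\<^sup>2"
      by (simp add: power2_eq_square)
    also have "240 * (real b)\<^sup>2 \<le> 240 * (2 * log 2 (real k))\<^sup>2"
      using b2 by (intro mult_left_mono power_mono) auto
    finally have "real k * real ((b + 4) * (2 * t)) \<le> real k * (960 * (log 2 (real k))\<^sup>2)"
      by (intro mult_left_mono) (auto simp: power_mult_distrib)
    then show ?thesis
      by (simp only: qnih_cost_def sum_constant card_lessThan of_nat_mult of_nat_id mult_ac)
  qed
  ultimately show "\<exists>q \<sigma> m M. qnih_protocol k q \<sigma> m M \<and>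
       real (qnih_cost k q) \<le> 960 * real k * (log 2 (real k))^2 \<and>
       (\<forall>E. is_graph k E \<longrightarrow> output_prob k \<sigma> m M E (neighborhood_diversity k E) \<ge> 2/3)"
    by blast
qed

end
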